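(* Let $\mathbb{F}$ be a finite field, let $u\in\mathbb{F}$, and let $$g_u(t)=t^{-1}\prod_{i=0}^{\infty}\bigl(1+u\,t^{-2^i}\bigr)\in\mathbb{F}((t^{-1})),$$ the Laurent series solution of $g_u(t)=(t+u)\,g_u(t^2)$. Then $g_u\notin\mathbf{ELC}$.
   Context: For $\alpha=\sum_{k=-h}^{\infty}a_kt^{-k}\in\mathbb{F}((t^{-1}))$ with $a_{-h}\neq0$, put $|\alpha|=2^h$ (and $|0|=0$). Define $\|\alpha\|=\min_{p\in\mathbb{F}[t]}|\alpha-p|=\bigl|\sum_{k\ge1}a_kt^{-k}\bigr|$. $\mathbf{ELC}$ is the set of $\alpha\in\mathbb{F}((t^{-1}))$ such that $\inf_{q\in\mathbb{F}[t]\setminus\{0\},\,k\ge0}|q|\cdot\|q\,t^k\alpha\|>0$, i.e. the set of counterexamples to the $t$-adic Littlewood conjecture. *)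

theory Defs
  imports
    "HOL-Analysis.Analysis"
    "HOL-Computational_Algebra.Computational_Algebra"
begin

unbundle fps_syntax

text \<open>
  The field \<open>F((t\<^sup>-\<^sup>1))\<close> is the library type \<open>'a fls\<close>, whose uniformizer \<^const>\<open>fls_X\<close> is read
  as \<open>t\<^sup>-\<^sup>1\<close>; hence \<^const>\<open>fls_X_inv\<close> is \<open>t\<close>, and \<open>\<alpha> $$ k\<close> is the coefficient of \<open>t\<^sup>-\<^sup>k\<close>.
\<close>

definition poly_to_fls :: "'a::field poly \<Rightarrow> 'a fls" where
  "poly_to_fls p = poly (map_poly fls_const p) fls_X_inv"

definition fls_abs :: "'a::field fls \<Rightarrow> real" where
  "fls_abs \<alpha> = (if \<alpha> = 0 then 0 else 2 powi (- fls_subdegree \<alpha>))"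

text \<open>The infimum is a minimum; see \<open>fls_dist_poly_attained\<close> and \<open>fls_dist_poly_eq\<close> below.\<close>

definition fls_dist_poly :: "'a::field fls \<Rightarrow> real" where
  "fls_dist_poly \<alpha> = (INF p. fls_abs (\<alpha> - poly_to_fls p))"

definition ELC :: "'a::field fls set" where
  "ELC = {\<alpha>. 0 < Inf {fls_abs (poly_to_fls q) * fls_dist_poly (poly_to_fls q * fls_X_inv ^ k * \<alpha>)
                        | (q :: 'a poly) (k :: nat). q \<noteq> 0}}"

text \<open>
  The infinite product is taken with respect to the metric topology of \<open>'a fls\<close>, whose distance
  is \<open>fls_abs (\<alpha> - \<beta>)\<close>; it converges by \<open>g_product_has_prod\<close> below.
\<close>

definition g_series :: "'a::field \<Rightarrow> 'a fls" where
  "g_series u = fls_X * (\<Prod>i. 1 + fls_const u * fls_X ^ (2 ^ i))"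


lemma dist_fls_eq_fls_abs: "dist \<alpha> \<beta> = fls_abs (\<alpha> - \<beta>)"
  by (auto simp: dist_fls_def fls_abs_def power_int_def inverse_eq_divide power_one_over)

lemma poly_to_fls_0 [simp]: "poly_to_fls 0 = 0"
  by (simp add: poly_to_fls_def)

lemma poly_to_fls_pCons: "poly_to_fls (pCons a p) = fls_const a + fls_X_inv * poly_to_fls p"
  by (cases "a = 0 \<and> p = 0") (auto simp: poly_to_fls_def map_poly_pCons)

lemma poly_to_fls_nth: "poly_to_fls p $$ k = (if k \<le> 0 then coeff p (nat (- k)) else 0)"
proof (induction p arbitrary: k)
  case 0
  show ?case by simp
next
  case (pCons a p)
  have "nat (- k) = Suc (nat (- (k + 1)))" if "k < 0"
    using that by simp
  with pCons.IH[of "k + 1"] show ?case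
    by (cases "k < 0") (auto simp: poly_to_fls_pCons fls_X_inv_times_conv_shift coeff_pCons)
qed

definition fls_frac :: "'a::field fls \<Rightarrow> 'a fls" where
  "fls_frac \<alpha> = Abs_fls (\<lambda>k. if k \<ge> 1 then \<alpha> $$ k else 0)"

lemma fls_frac_nth: "fls_frac \<alpha> $$ k = (if k \<ge> 1 then \<alpha> $$ k else 0)"
  unfolding fls_frac_def by (rule nth_Abs_fls_lower_bound[of 0]) auto

lemma fls_frac_eq_diff: "fls_frac \<alpha> = \<alpha> - poly_to_fls (fls_prpart \<alpha> + [:\<alpha> $$ 0:])"
proof (rule fls_eqI)
  fix k :: int
  consider "k < 0" | "k = 0" | "k \<ge> 1" by linarith
  then show "fls_frac \<alpha> $$ k = (\<alpha> - poly_to_fls (fls_prpart \<alpha> + [:\<alpha> $$ 0:])) $$ k"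
    by cases (auto simp: fls_frac_nth poly_to_fls_nth coeff_pCons split: nat.splits)
qed

lemma fls_abs_frac_le: "fls_abs (fls_frac \<alpha>) \<le> fls_abs (\<alpha> - poly_to_fls p)"
proof (cases "fls_frac \<alpha> = 0")
  case True
  then show ?thesis by (simp add: fls_abs_def)
next
  case False
  define n where "n = fls_subdegree (fls_frac \<alpha>)"
  have nz: "fls_frac \<alpha> $$ n \<noteq> 0"
    using False by (simp add: n_def)
  hence "n \<ge> 1"
    by (auto simp: fls_frac_nth split: if_splits)
  with nz have "(\<alpha> - poly_to_fls p) $$ n \<noteq> 0"
    by (auto simp: fls_frac_nth poly_to_fls_nth)
  hence "fls_subdegree (\<alpha> - poly_to_fls p) \<le> n" "\<alpha> - poly_to_fls p \<noteq> 0"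
    by (auto intro: fls_subdegree_leI)
  with False show ?thesis
    by (auto simp: fls_abs_def n_def intro!: power_int_increasing)
qed

lemma fls_dist_poly_eq: "fls_dist_poly \<alpha> = fls_abs (fls_frac \<alpha>)"
  unfolding fls_dist_poly_def
proof (rule cInf_eq_minimum)
  show "fls_abs (fls_frac \<alpha>) \<in> range (\<lambda>p. fls_abs (\<alpha> - poly_to_fls p))"
    by (subst fls_frac_eq_diff) blast
qed (auto simp: fls_abs_frac_le)

lemma fls_dist_poly_attained: "\<exists>p. fls_dist_poly \<alpha> = fls_abs (\<alpha> - poly_to_fls p)"
  using fls_dist_poly_eq fls_frac_eq_diff by metis


context
  fixes u :: "'a::field"
begin

private definition P :: "nat \<Rightarrow> 'a fps" where
  "P n = (\<Prod>i\<le>n. 1 + fps_const u * fps_X ^ (2 ^ i))"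

private definition G :: "'a fps" where
  "G = Abs_fps (\<lambda>k. fps_nth (P k) k)"

private lemma P_Suc: "P (Suc n) = P n + fps_const u * P n * fps_X ^ (2 ^ Suc n)"
  unfolding P_def by (subst prod.atMost_Suc) (simp add: algebra_simps)

private lemma P_nth: "k \<le> n \<Longrightarrow> fps_nth (P n) k = fps_nth G k"
proof (induction n rule: dec_induct)
  case base
  then show ?case by (simp add: G_def)
next
  case (step n)
  have "Suc n < 2 ^ Suc n"
    by (rule less_exp)
  with step have "k < 2 ^ Suc n"
    by linarith
  then have "fps_nth (P (Suc n)) k = fps_nth (P n) k"
    by (simp add: P_Suc fps_X_power_mult_right_nth del: power_Suc)
  with step show ?case by simp
qed

private lemma P_fls: "fps_to_fls (P n) = (\<Prod>i\<le>n. 1 + fls_const u * fls_X ^ (2 ^ i))"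
proof (induction n)
  case 0
  show ?case by (simp add: P_def fls_times_fps_to_fls)
next
  case (Suc n)
  have "P (Suc n) = P n * (1 + fps_const u * fps_X ^ (2 ^ Suc n))"
    by (simp add: P_def)
  with Suc show ?case
    by (simp add: fls_times_fps_to_fls fps_to_fls_power del: power_Suc)
qed

private lemma G_has_prod: "(\<lambda>i. 1 + fls_const u * fls_X ^ (2 ^ i)) has_prod fps_to_fls G"
proof -
  have lim: "(\<lambda>n. fps_to_fls (P n)) \<longlonglongrightarrow> fps_to_fls G"
  proof (rule metric_LIMSEQ_I)
    fix e :: real assume "e > 0"
    then obtain N where N: "inverse 2 ^ N < e"
      using real_arch_pow_inv[of e "inverse 2"] by auto
    have "dist (fps_to_fls (P n)) (fps_to_fls G) < e" if "n \<ge> N" for n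
    proof (cases "P n = G")
      case False
      define d where "d = subdegree (P n - G)"
      have "fps_nth (P n - G) d \<noteq> 0"
        unfolding d_def using False by (intro nth_subdegree_nonzero) simp
      hence "n < d"
        using P_nth[of d n] by (cases "d \<le> n") auto
      have "dist (fps_to_fls (P n)) (fps_to_fls G) = inverse 2 ^ d"
        using False
        by (simp add: dist_fls_def fls_subdegree_fls_to_fps d_def power_one_over inverse_eq_divide
            flip: fps_to_fls_minus)
      also have "\<dots> \<le> inverse 2 ^ N"
        using \<open>n < d\<close> that by (intro power_decreasing) auto
      finally show ?thesis using N by simp
    qed (use \<open>e > 0\<close> in auto)
    thus "\<exists>N. \<forall>n\<ge>N. dist (fps_to_fls (P n)) (fps_to_fls G) < e" by blast
  qed
  have "fps_nth G 0 = 1"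
    by (simp add: G_def P_def)
  hence "fps_to_fls G \<noteq> 0"
    by auto
  with lim show ?thesis
    by (auto simp: has_prod_def raw_has_prod_def P_fls)
qed

lemma g_product_has_prod:
  "(\<lambda>i. 1 + fls_const u * fls_X ^ (2 ^ i)) has_prod (\<Prod>i. 1 + fls_const u * fls_X ^ (2 ^ i))"
  using G_has_prod has_prod_unique by metis

private lemma g_series_conv: "g_series u = fps_to_fls (fps_X * G)"
  using has_prod_unique[OF G_has_prod] by (simp add: g_series_def fls_times_fps_to_fls)

private lemma G_functional: "G = (1 + fps_const u * fps_X) * (G oo fps_X ^ 2)"
proof (rule fps_ext)
  fix k
  have split: "P (Suc n) = (1 + fps_const u * fps_X) * (P n oo fps_X ^ 2)" for n
  proof -
    have "P n oo fps_X ^ 2 = (\<Prod>i\<le>n. 1 + fps_const u * fps_X ^ (2 ^ Suc i))"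
      by (simp add: P_def fps_compose_prod_distrib fps_compose_add_distrib
          fps_compose_mult_distrib flip: fps_compose_power power_mult)
    thus ?thesis
      unfolding P_def by (subst prod.atMost_Suc_shift) simp
  qed
  have *: "fps_nth (P k oo fps_X ^ 2) j = fps_nth (G oo fps_X ^ 2) j" if "j \<le> k" for j
    using that P_nth[of "j div 2" k] by (auto simp: fps_nth_compose_X_power)
  have "fps_nth G k = fps_nth (P (Suc k)) k"
    by (simp add: P_nth)
  also have "\<dots> = fps_nth ((1 + fps_const u * fps_X) * (G oo fps_X ^ 2)) k"
    by (simp add: split ring_distribs mult.assoc *)
  finally show "fps_nth G k = fps_nth ((1 + fps_const u * fps_X) * (G oo fps_X ^ 2)) k" .
qed

lemma g_series_functional_equation:
  "g_series u = (fls_X_inv + fls_const u) * fls_compose_power (g_series u) 2"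
proof -
  have X: "(fls_X_inv :: 'a fls) * fls_X = 1"
    by (simp add: fls_X_inv_times_conv_shift)
  have X2: "fls_X_intpow 2 = (fls_X :: 'a fls) * fls_X"
    by (simp add: fls_X_times_conv_shift fls_eq_iff)
  have "(fls_X_inv + fls_const u) * fls_compose_power (g_series u) 2 =
          (fls_X_inv + fls_const u) * fls_X * (fls_X * fps_to_fls (G oo fps_X ^ 2))"
    by (simp add: g_series_conv fls_times_fps_to_fls fls_compose_power_fps_to_fls X2 mult_ac)
  also have "(fls_X_inv + fls_const u) * fls_X = fps_to_fls (1 + fps_const u * fps_X)"
    by (simp add: ring_distribs X fls_times_fps_to_fls)
  also have "\<dots> * (fls_X * fps_to_fls (G oo fps_X ^ 2)) = g_series u"
  proof -
    have "g_series u = fps_to_fls (fps_X * ((1 + fps_const u * fps_X) * (G oo fps_X ^ 2)))"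
      by (simp only: g_series_conv G_functional[symmetric])
    thus ?thesis by (simp add: fls_times_fps_to_fls mult_ac)
  qed
  finally show ?thesis ..
qed

end

end

theory Submission
  imports Defs
begin

text \<open>
  Suppose that \<open>|q| = 2^d\<close> and that \<open>q t\<^sup>k g\<close> differs from a polynomial by \<open>r\<close> with \<open>|r| < 2^(-m)\<close>.
  Substituting \<open>t\<^sup>2\<close> for \<open>t\<close> and multiplying by \<open>t + u\<close>, the functional equation turns this into the
  same statement with \<open>(2d, 2m)\<close> in place of \<open>(d, m)\<close>. So \<open>g\<close> is not in \<open>ELC\<close> as soon as some pair
  with \<open>m > d\<close> occurs. For \<open>u \<noteq> 0\<close> let \<open>u\<^sup>N = 1\<close>, \<open>N > 0\<close>: the coefficients of \<open>g\<close> at \<open>2^N\<close>, \<open>2^N + 1\<close>,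
  \<open>2^N + 2\<close> are \<open>u\<^sup>N, u, u\<^sup>2\<close>, a geometric progression of ratio \<open>u\<close>, so \<open>q = t - u\<close> and \<open>k = 2^N - 1\<close>
  give the pair \<open>(1, 2)\<close>.
\<close>

lemma poly_to_fls_add: "poly_to_fls (p + q) = poly_to_fls p + poly_to_fls q"
  by (simp add: fls_eq_iff poly_to_fls_nth)

lemma poly_to_fls_mult: "poly_to_fls (p * q) = poly_to_fls p * poly_to_fls q"
proof (induction p)
  case (pCons a p)
  have "poly_to_fls (smult a q) = fls_const a * poly_to_fls q"
    by (simp add: fls_eq_iff poly_to_fls_nth)
  then show ?case
    using pCons by (simp add: poly_to_fls_pCons poly_to_fls_add algebra_simps)
qed simp

lemma fls_compose_X_inv_square: "fls_compose_power (fls_X_inv :: 'a::field fls) 2 = fls_X_inv ^ 2"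
proof -
  have "(fls_X_inv :: 'a fls) ^ 2 = fls_X_intpow (-2)"
    by (simp add: fls_X_inv_power_conv_shift_1)
  thus ?thesis
    by (auto simp: fls_eq_iff fls_nth_compose_power)
qed

lemma poly_to_fls_pcompose_square:
  "poly_to_fls (pcompose p [:0, 0, 1:]) = fls_compose_power (poly_to_fls p) 2"
proof (induction p)
  case (pCons a p)
  have "poly_to_fls [:0, 0, 1:] = (fls_X_inv :: 'a fls) ^ 2"
    by (simp add: poly_to_fls_pCons power2_eq_square)
  then show ?case
    using pCons by (simp add: pcompose_pCons poly_to_fls_pCons poly_to_fls_add poly_to_fls_mult
        fls_compose_X_inv_square)
qed simp

lemma fls_abs_nonneg: "fls_abs \<alpha> \<ge> 0"
  by (simp add: fls_abs_def)

lemma fls_abs_le: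
  assumes "\<And>i. i \<le> m \<Longrightarrow> \<alpha> $$ i = 0"
  shows "fls_abs \<alpha> \<le> 2 powi (- m)"
proof (cases "\<alpha> = 0")
  case False
  then have "m \<le> fls_subdegree \<alpha>"
    using assms[of "fls_subdegree \<alpha>"] by (cases "fls_subdegree \<alpha> \<le> m") auto
  with False show ?thesis
    by (auto simp: fls_abs_def intro!: power_int_increasing)
qed (simp add: fls_abs_def)

lemma fls_abs_poly_to_fls_le:
  assumes "degree p \<le> d"
  shows "fls_abs (poly_to_fls p) \<le> 2 ^ d"
proof (cases "poly_to_fls p = 0")
  case False
  have "coeff p (nat (- i)) = 0" if "i < - int d" for i
    using that assms by (intro coeff_eq_0) linarith
  with False have "- int d \<le> fls_subdegree (poly_to_fls p)"
    by (intro fls_subdegree_geI) (auto simp: poly_to_fls_nth)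
  then have "(2::real) powi (- fls_subdegree (poly_to_fls p)) \<le> 2 powi int d"
    by (intro power_int_increasing) auto
  with False show ?thesis by (simp add: fls_abs_def)
qed (simp add: fls_abs_def)

text \<open>Vanishing through index \<open>m\<close> encodes that the error is smaller than 2^(-m).
  Only an upper bound on the degree of \<open>q\<close> is recorded, since the quantity to be made
  small grows with |q|.\<close>

definition shifted_approximable :: "'a::field fls \<Rightarrow> nat \<Rightarrow> nat \<Rightarrow> bool" where
  "shifted_approximable \<alpha> d m \<longleftrightarrow>
     (\<exists>q p k. q \<noteq> 0 \<and> degree q \<le> d \<and>
        (\<forall>i \<le> int m. (poly_to_fls q * fls_X_inv ^ k * \<alpha> - poly_to_fls p) $$ i = 0))"

lemma shifted_approximable_double:
  assumes \<alpha>: "\<alpha> = (fls_X_inv + fls_const u) * fls_compose_power \<alpha> 2"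
    and "shifted_approximable \<alpha> d m"
  shows "shifted_approximable \<alpha> (2 * d) (2 * m)"
proof -
  obtain q p k where q: "q \<noteq> 0" "degree q \<le> d"
    and r: "\<And>i. i \<le> int m \<Longrightarrow> (poly_to_fls q * fls_X_inv ^ k * \<alpha> - poly_to_fls p) $$ i = 0"
    using assms(2) unfolding shifted_approximable_def by blast
  define r where "r = poly_to_fls q * fls_X_inv ^ k * \<alpha> - poly_to_fls p"
  define q' where "q' = pcompose q [:0, 0, 1:]"
  \<comment> \<open>The factor t + u enters the polynomial part only: on the other side it turns
    \<alpha>(t^2) back into \<alpha>, so the degree of \<open>q'\<close> merely doubles.\<close>
  define p' where "p' = [:u, 1:] * pcompose p [:0, 0, 1:]"
  have "(fls_X_inv + fls_const u) * fls_compose_power r 2 =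
          poly_to_fls q' * (fls_X_inv ^ 2) ^ k * ((fls_X_inv + fls_const u) * fls_compose_power \<alpha> 2)
            - poly_to_fls p'"
    unfolding r_def q'_def p'_def poly_to_fls_mult
    by (simp add: poly_to_fls_pcompose_square poly_to_fls_pCons fls_compose_X_inv_square
        right_diff_distrib left_diff_distrib distrib_left distrib_right mult_ac
        del: fls_compose_power_X_inv)
  then have *: "poly_to_fls q' * fls_X_inv ^ (2 * k) * \<alpha> - poly_to_fls p' =
          (fls_X_inv + fls_const u) * fls_compose_power r 2"
    by (simp add: power_mult flip: \<alpha>)
  \<comment> \<open>The error starts at index m + 1 or later, hence at 2m + 2 or later after the
    substitution. The spare index 2m + 1 pays for the shift caused by
    \<open>fls_X_inv\<close>.\<close>
  have zero: "fls_compose_power r 2 $$ i = 0" if "i \<le> 2 * int m + 1" for i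
    using that r[folded r_def] by (auto simp: fls_nth_compose_power)
  have "((fls_X_inv + fls_const u) * fls_compose_power r 2) $$ i = 0" if "i \<le> int (2 * m)" for i
    using that by (simp add: ring_distribs fls_X_inv_times_conv_shift zero)
  moreover have "q' \<noteq> 0"
    using q by (simp add: q'_def pcompose_eq_0_iff)
  moreover have "degree q' \<le> 2 * d"
    using q by (simp add: q'_def degree_pcompose)
  ultimately show ?thesis
    unfolding shifted_approximable_def * [symmetric] by blast
qed

lemma shifted_approximable_pow2:
  assumes "\<alpha> = (fls_X_inv + fls_const u) * fls_compose_power \<alpha> 2"
    and "shifted_approximable \<alpha> d m"
  shows "shifted_approximable \<alpha> (2 ^ j * d) (2 ^ j * m)"
proof (induction j)
  case (Suc j)
  from shifted_approximable_double[OF assms(1) this] show ?case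
    by (simp add: mult.assoc)
qed (use assms(2) in simp)

lemma shifted_approximable_bound:
  assumes "shifted_approximable \<alpha> d m"
  shows "\<exists>q k. q \<noteq> 0 \<and>
           fls_abs (poly_to_fls q) * fls_dist_poly (poly_to_fls q * fls_X_inv ^ k * \<alpha>) \<le> 2 ^ d / 2 ^ m"
proof -
  obtain q p k where q: "q \<noteq> 0" "degree q \<le> d"
    and r: "\<And>i. i \<le> int m \<Longrightarrow> (poly_to_fls q * fls_X_inv ^ k * \<alpha> - poly_to_fls p) $$ i = 0"
    using assms unfolding shifted_approximable_def by blast
  have "fls_dist_poly (poly_to_fls q * fls_X_inv ^ k * \<alpha>)
          \<le> fls_abs (poly_to_fls q * fls_X_inv ^ k * \<alpha> - poly_to_fls p)"
    by (simp add: fls_dist_poly_eq fls_abs_frac_le)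
  also have "\<dots> \<le> 2 powi (- int m)"
    using r by (rule fls_abs_le)
  finally have "fls_abs (poly_to_fls q) * fls_dist_poly (poly_to_fls q * fls_X_inv ^ k * \<alpha>)
      \<le> 2 ^ d * 2 powi (- int m)"
    using q by (intro mult_mono fls_abs_poly_to_fls_le) (auto simp: fls_dist_poly_eq fls_abs_nonneg)
  with q show ?thesis
    by (auto simp: power_int_minus divide_inverse)
qed

text \<open>Doubling j times multiplies the gap m - d by 2^j, so the products whose infimum defines
  \<open>ELC\<close> come arbitrarily close to 0.\<close>

lemma not_ELC_if_shifted_approximable:
  assumes "\<alpha> = (fls_X_inv + fls_const u) * fls_compose_power \<alpha> 2"
    and "shifted_approximable \<alpha> d m" and "d < m"
  shows "\<alpha> \<notin> ELC"
proof
  define S where "S = {fls_abs (poly_to_fls q) * fls_dist_poly (poly_to_fls q * fls_X_inv ^ k * \<alpha>)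
                        | q k. q \<noteq> 0}"
  assume "\<alpha> \<in> ELC"
  then have "0 < Inf S"
    by (simp add: ELC_def S_def)
  then obtain j where j: "(1 / 2) ^ j < Inf S"
    using real_arch_pow_inv[of "Inf S" "1 / 2"] by auto
  obtain q k where qk: "q \<noteq> 0"
    "fls_abs (poly_to_fls q) * fls_dist_poly (poly_to_fls q * fls_X_inv ^ k * \<alpha>)
       \<le> 2 ^ (2 ^ j * d) / 2 ^ (2 ^ j * m)"
    using shifted_approximable_bound[OF shifted_approximable_pow2[OF assms(1,2)]] by blast
  have "bdd_below S"
    by (rule bdd_belowI[of _ 0]) (auto simp: S_def fls_dist_poly_eq fls_abs_nonneg)
  then have "Inf S \<le> fls_abs (poly_to_fls q) * fls_dist_poly (poly_to_fls q * fls_X_inv ^ k * \<alpha>)"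
    using qk(1) by (intro cInf_lower) (auto simp: S_def)
  also note qk(2)
  also have "(2::real) ^ (2 ^ j * d) / 2 ^ (2 ^ j * m) \<le> (1 / 2) ^ j"
  proof -
    \<comment> \<open>The enlarged gap 2^j * (m - d) is at least 2^j, which exceeds j.\<close>
    have "j + 2 ^ j * d \<le> 2 ^ j * (d + 1)"
      using less_exp[of j] by simp
    also have "\<dots> \<le> 2 ^ j * m"
      using assms(3) by (intro mult_left_mono) auto
    finally have "(2::real) ^ (j + 2 ^ j * d) \<le> 2 ^ (2 ^ j * m)"
      by (intro power_increasing) auto
    thus ?thesis
      by (simp add: field_simps power_add)
  qed
  finally show False
    using j by simp
qed

text \<open>The series g(t^2) has coefficients at even indices only. In (t + u) g(t^2) the summand
  from t therefore fills the odd indices and the summand from u the even ones.\<close>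

lemma g_series_nth_even: "g_series u $$ (2 * n) = u * g_series u $$ n"
  and g_series_nth_odd: "g_series u $$ (2 * n - 1) = g_series u $$ n"
proof -
  have "g_series u $$ i = fls_compose_power (g_series u) 2 $$ (i + 1)
          + u * fls_compose_power (g_series u) 2 $$ i" for i
    by (subst g_series_functional_equation)
      (simp add: ring_distribs fls_X_inv_times_conv_shift)
  from this[of "2 * n"] this[of "2 * n - 1"]
  show "g_series u $$ (2 * n) = u * g_series u $$ n" "g_series u $$ (2 * n - 1) = g_series u $$ n"
    by (simp_all add: fls_nth_compose_power)
qed

lemma g_series_nth_pow2: "g_series u $$ (2 ^ n) = u ^ n * g_series u $$ 1"
  by (induction n) (simp_all add: g_series_nth_even mult.assoc)

text \<open>The factor u arises once, at index 2; afterwards 2^(n+1) + 1 = 2 (2^n + 1) - 1 is odd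
  and the value is passed on unchanged.\<close>

lemma g_series_nth_pow2_plus_1: "g_series u $$ (2 ^ n + 1) = u * g_series u $$ 1"
proof (induction n)
  case 0
  show ?case using g_series_nth_even[of u 1] by simp
next
  case (Suc n)
  show ?case using g_series_nth_odd[of u "2 ^ n + 1"] Suc by (simp add: algebra_simps)
qed

text \<open>Multiplication by t - u cancels consecutive coefficients of ratio u, so this
  \<open>k\<close> makes two fractional coefficients vanish.\<close>

lemma g_series_geometric:
  assumes "u ^ Suc n = 1 \<or> u = 0"
  shows "\<exists>k. g_series u $$ (int k + 2) = u * g_series u $$ (int k + 1) \<and>
             g_series u $$ (int k + 3) = u * g_series u $$ (int k + 2)"
proof (cases "u = 0")
  \<comment> \<open>Here g is t^(-1), whose coefficients at 2 and 3 are 0, so no shift is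
    required.\<close>
  case True
  then show ?thesis
    using g_series_nth_even[of u 1] g_series_nth_odd[of u 2] by (intro exI[of _ 0]) simp
next
  case False
  have k: "int (2 ^ Suc n - 1) = 2 ^ Suc n - 1"
    by (simp add: of_nat_diff del: power_Suc)
  have "g_series u $$ (2 ^ Suc n + 2) = u * (u * g_series u $$ 1)"
    using g_series_nth_even[of u "2 ^ n + 1"] by (simp add: g_series_nth_pow2_plus_1)
  moreover have "g_series u $$ (2 ^ Suc n) = g_series u $$ 1"
    using assms False by (simp add: g_series_nth_pow2 del: power_Suc)
  ultimately show ?thesis
    using g_series_nth_pow2_plus_1[of u "Suc n"]
    by (intro exI[of _ "2 ^ Suc n - 1"]) (simp add: k add.commute del: power_Suc)
qed

text \<open>Pigeonhole: two powers of u with different exponents coincide, and the smaller one can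
  be cancelled.\<close>

lemma finite_field_power_eq_1:
  fixes u :: "'a::{field, finite}"
  assumes "u \<noteq> 0"
  shows "\<exists>n. u ^ Suc n = 1"
proof -
  have "\<not> inj (\<lambda>n. u ^ n)"
    using finite_imageD[of "\<lambda>n. u ^ n" UNIV] by auto
  then obtain i j where "i < j" "u ^ i = u ^ j"
    by (metis injI linorder_neqE_nat)
  then have "u ^ i * u ^ Suc (j - Suc i) = u ^ i"
    by (subst power_add [symmetric]) simp
  with assms show ?thesis
    by (intro exI[of _ "j - Suc i"]) (simp del: power_Suc)
qed

theorem theorem3:
  fixes u :: "'a::finite_field"
  shows "g_series u \<notin> ELC"
proof -
  obtain n where "u ^ Suc n = 1 \<or> u = 0"
    using finite_field_power_eq_1 by blast
  from g_series_geometric[OF this] obtain k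
    where k: "g_series u $$ (int k + 2) = u * g_series u $$ (int k + 1)"
      "g_series u $$ (int k + 3) = u * g_series u $$ (int k + 2)"
    by blast
  define \<beta> where "\<beta> = poly_to_fls [:-u, 1:] * fls_X_inv ^ k * g_series u"
  have "poly_to_fls [:-u, 1:] = fls_X_inv - fls_const u"
    by (simp add: poly_to_fls_pCons)
  then have "\<beta> = (fls_X_inv - fls_const u) * fls_shift (int k) (g_series u)"
    by (simp only: \<beta>_def mult.assoc fls_X_inv_power_times_conv_shift(1))
  then have \<beta>_nth: "\<beta> $$ i = g_series u $$ (i + int k + 1) - u * g_series u $$ (i + int k)" for i
    by (simp add: ring_distribs left_diff_distrib fls_X_inv_times_conv_shift add_ac)
  \<comment> \<open>Passing to \<open>fls_frac\<close> subtracts the polynomial part, which serves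
    as the witness \<open>p\<close>; only the indices 1 and 2 remain to be checked.\<close>
  have "fls_frac \<beta> $$ i = 0" if i: "i \<le> 2" for i :: int
  proof -
    consider "i \<le> 0" | "i = 1" | "i = 2" using i by linarith
    then show ?thesis
      using k by cases (auto simp: fls_frac_nth \<beta>_nth add_ac)
  qed
  then have "shifted_approximable (g_series u) 1 2"
    unfolding shifted_approximable_def fls_frac_eq_diff \<beta>_def
    by (intro exI[of _ "[:-u, 1:]"] exI) auto
  then show ?thesis
    by (rule not_ELC_if_shifted_approximable[OF g_series_functional_equation]) simp
qed

end
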